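(* Let $G$ be a finite group with center $Z(G)$. If $G/Z(G) \cong D_{2m}$ for some positive integer $m$, where $D_{2m} = \langle a,b : a^m = b^2 = 1,\ bab^{-1} = a^{-1}\rangle$, then $E(\Gamma_{nc}(G)) \leq LE(\Gamma_{nc}(G))$.
   Context: For a finite non-abelian group $G$ with center $Z(G)$, the non-commuting graph $\Gamma_{nc}(G)$ is the simple undirected graph with vertex set $G\setminus Z(G)$, in which two vertices $x,y$ are adjacent if and only if $xy \ne yx$. For a finite simple graph $\mathcal{G}$ with vertex set $v(\mathcal{G})$ and edge set $e(\mathcal{G})$, the energy $E(\mathcal{G})$ is the sum of $|\lambda|$ over the eigenvalues $\lambda$ of the adjacency matrix $\mathcal{A}(\mathcal{G})$, and the Laplacian energy is $LE(\mathcal{G}) = \sum_{\mu}\left|\mu - \frac{2|e(\mathcal{G})|}{|v(\mathcal{G})|}\right|$, the sum over the eigenvalues $\mu$ of the Laplacian matrix $L(\mathcal{G}) = D(\mathcal{G}) - \mathcal{A}(\mathcal{G})$, where $D(\mathcal{G})$ is the diagonal degree matrix; eigenvalues are counted with multiplicity. *)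

theory Defs
  imports
    "HOL-Algebra.Coset"
    "HOL-Computational_Algebra.Fundamental_Theorem_Algebra"
    "Jordan_Normal_Form.Char_Poly"
begin

section \<open>Centre and dihedral groups\<close>

definition center :: "('a, 'c) monoid_scheme \<Rightarrow> 'a set" where
  "center G = {z \<in> carrier G. \<forall>x \<in> carrier G. z \<otimes>\<^bsub>G\<^esub> x = x \<otimes>\<^bsub>G\<^esub> z}"

text \<open>Words in the generators of type \<open>'g\<close> and their formal inverses:
  \<open>(x, True)\<close> stands for \<open>x\<close> and \<open>(x, False)\<close> for the inverse of \<open>x\<close>.\<close>

type_synonym 'g word = "('g \<times> bool) list"

text \<open>A set of relations is a set of pairs \<open>(l, r)\<close> of words, to be read as \<open>l = r\<close>.
  \<open>word_eq R\<close> is the least congruence on words that contains \<open>R\<close> and free cancellation.\<close>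

inductive word_eq :: "('g word \<times> 'g word) set \<Rightarrow> 'g word \<Rightarrow> 'g word \<Rightarrow> bool" for R where
  refl: "word_eq R u u"
| sym: "word_eq R u v \<Longrightarrow> word_eq R v u"
| trans: "word_eq R u v \<Longrightarrow> word_eq R v w \<Longrightarrow> word_eq R u w"
| cancel: "word_eq R (u @ [(x, e), (x, \<not> e)] @ v) (u @ v)"
| rel: "(l, r) \<in> R \<Longrightarrow> word_eq R (u @ l @ v) (u @ r @ v)"

definition presented_group :: "('g word \<times> 'g word) set \<Rightarrow> 'g word set monoid" where
  "presented_group R =
    \<lparr>carrier = UNIV // {(u, v). word_eq R u v},
     monoid.mult = (\<lambda>X Y. {w. \<exists>u \<in> X. \<exists>v \<in> Y. word_eq R (u @ v) w}),
     monoid.one = {w. word_eq R [] w}\<rparr>"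

datatype dihedral_gen = GenA | GenB

text \<open>The relations are \<open>a ^ m = 1\<close>, \<open>b ^ 2 = 1\<close> and \<open>b a b\<inverse> = a\<inverse>\<close>.
  The index \<open>m\<close> is half the group order, so this is \<open>D\<^sub>2\<^sub>m\<close>.\<close>

definition dihedral_relations :: "nat \<Rightarrow> (dihedral_gen word \<times> dihedral_gen word) set" where
  "dihedral_relations m =
    {(replicate m (GenA, True), []),
     (replicate 2 (GenB, True), []),
     ([(GenB, True), (GenA, True), (GenB, False)], [(GenA, False)])}"

definition dihedral_group :: "nat \<Rightarrow> dihedral_gen word set monoid" where
  "dihedral_group m = presented_group (dihedral_relations m)"


section \<open>Simple graphs, energy and Laplacian energy\<close>

record 'a ugraph =
  verts :: "'a set"
  edges :: "'a set set"

definition degree_of :: "'a ugraph \<Rightarrow> 'a \<Rightarrow> nat" where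
  "degree_of \<Gamma> x = card {e \<in> edges \<Gamma>. x \<in> e}"

text \<open>Matrices need numbered rows and columns, so an arbitrary enumeration of the (finite)
  vertex set is fixed. Another choice conjugates the matrices below by a permutation matrix,
  which does not affect their eigenvalues.\<close>

definition vertex_enum :: "'a ugraph \<Rightarrow> 'a list" where
  "vertex_enum \<Gamma> = (SOME vs. distinct vs \<and> set vs = verts \<Gamma>)"

definition adjacency_matrix :: "'a ugraph \<Rightarrow> complex mat" where
  "adjacency_matrix \<Gamma> = (let vs = vertex_enum \<Gamma>; n = length vs in
     mat n n (\<lambda>(i, j). if {vs ! i, vs ! j} \<in> edges \<Gamma> then 1 else 0))"

definition degree_matrix :: "'a ugraph \<Rightarrow> complex mat" where
  "degree_matrix \<Gamma> = (let vs = vertex_enum \<Gamma>; n = length vs in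
     mat n n (\<lambda>(i, j). if i = j then of_nat (degree_of \<Gamma> (vs ! i)) else 0))"

definition laplacian_matrix :: "'a ugraph \<Rightarrow> complex mat" where
  "laplacian_matrix \<Gamma> = degree_matrix \<Gamma> - adjacency_matrix \<Gamma>"

text \<open>Matrices are taken over the complex numbers so that the roots of the characteristic
  polynomial are all the eigenvalues, each occurring with its multiplicity.\<close>

definition eigenvalues :: "complex mat \<Rightarrow> complex multiset" where
  "eigenvalues M = proots (char_poly M)"

definition energy :: "'a ugraph \<Rightarrow> real" where
  "energy \<Gamma> = (\<Sum>x \<in># eigenvalues (adjacency_matrix \<Gamma>). cmod x)"

definition laplacian_energy :: "'a ugraph \<Rightarrow> real" where
  "laplacian_energy \<Gamma> =
    (\<Sum>\<mu> \<in># eigenvalues (laplacian_matrix \<Gamma>).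
       cmod (\<mu> - 2 * of_nat (card (edges \<Gamma>)) / of_nat (card (verts \<Gamma>))))"

definition noncommuting_graph :: "('a, 'c) monoid_scheme \<Rightarrow> 'a ugraph" where
  "noncommuting_graph G =
    \<lparr>verts = carrier G - center G,
     edges = {{x, y} | x y. x \<in> carrier G - center G \<and> y \<in> carrier G - center G \<and>
                            x \<otimes>\<^bsub>G\<^esub> y \<noteq> y \<otimes>\<^bsub>G\<^esub> x}\<rparr>"


section \<open>Sanity checks\<close>

lemma (in group) center_normal: "center G \<lhd> G"
proof (rule normal_invI)
  show "subgroup (center G) G"
  proof (rule subgroupI)
    show "center G \<noteq> {}" by (auto simp: center_def intro: exI[of _ "\<one>"])
  next
    fix z assume z: "z \<in> center G"
    have "inv z \<otimes> x = x \<otimes> inv z" if x: "x \<in> carrier G" for x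
    proof -
      have "z \<in> carrier G" "z \<otimes> x = x \<otimes> z" using z x by (auto simp: center_def)
      then show ?thesis using x
        by (metis inv_closed inv_solve_left inv_solve_right m_assoc m_closed)
    qed
    moreover have "inv z \<in> carrier G" using z unfolding center_def by blast
    ultimately show "inv z \<in> center G" unfolding center_def by blast
  next
    fix y z assume y: "y \<in> center G" and z: "z \<in> center G"
    have "(y \<otimes> z) \<otimes> x = x \<otimes> (y \<otimes> z)" if x: "x \<in> carrier G" for x
    proof -
      have c: "y \<in> carrier G" "z \<in> carrier G" and yx: "y \<otimes> x = x \<otimes> y" and zx: "z \<otimes> x = x \<otimes> z"
        using x y z by (auto simp: center_def)
      have "(y \<otimes> z) \<otimes> x = y \<otimes> (z \<otimes> x)" using x c by (simp only: m_assoc)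
      also have "\<dots> = (y \<otimes> x) \<otimes> z" using x c by (simp only: zx m_assoc)
      also have "\<dots> = x \<otimes> (y \<otimes> z)" using x c by (simp only: yx m_assoc)
      finally show ?thesis .
    qed
    moreover have "y \<otimes> z \<in> carrier G" using y z unfolding center_def by blast
    ultimately show "y \<otimes> z \<in> center G" unfolding center_def by blast
  qed (auto simp: center_def)
next
  fix x h assume x: "x \<in> carrier G" and h: "h \<in> center G"
  have "h \<in> carrier G" "x \<otimes> h = h \<otimes> x" using x h by (auto simp: center_def)
  then have "x \<otimes> h \<otimes> inv x = h" using x by (simp add: m_assoc)
  then show "x \<otimes> h \<otimes> inv x \<in> center G" using h by simp
qed

lemma vertex_enum:
  assumes "finite (verts \<Gamma>)"
  shows "distinct (vertex_enum \<Gamma>)" "set (vertex_enum \<Gamma>) = verts \<Gamma>"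
proof -
  have "\<exists>vs. distinct vs \<and> set vs = verts \<Gamma>"
    using finite_distinct_list[OF assms] by blast
  from someI_ex[OF this] show "distinct (vertex_enum \<Gamma>)" "set (vertex_enum \<Gamma>) = verts \<Gamma>"
    by (auto simp: vertex_enum_def)
qed

lemma
  assumes M: "M \<in> carrier_mat n n"
  shows set_eigenvalues: "set_mset (eigenvalues M) = {k. eigenvalue M k}"
    and size_eigenvalues: "size (eigenvalues M) = n"
proof -
  have "char_poly M \<noteq> 0" using degree_monic_char_poly[OF M] by auto
  then show "set_mset (eigenvalues M) = {k. eigenvalue M k}"
    by (simp add: eigenvalues_def eigenvalue_root_char_poly[OF M])
  show "size (eigenvalues M) = n"
    using degree_monic_char_poly[OF M] by (simp add: eigenvalues_def size_proots_complex)
qed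

lemma word_eq_append:
  assumes "word_eq R u u'" "word_eq R v v'"
  shows "word_eq R (u @ v) (u' @ v')"
proof -
  have left: "word_eq R (w @ x) (w @ y)" if "word_eq R x y" for w x y
    using that
  proof induction
    case (cancel u x e v)
    then show ?case using word_eq.cancel[of R "w @ u" x e v] by simp
  next
    case (rel l r u v)
    then show ?case using word_eq.rel[of l r R "w @ u" v] by simp
  qed (auto intro: word_eq.intros)
  have right: "word_eq R (x @ w) (y @ w)" if "word_eq R x y" for w x y
    using that
  proof induction
    case (cancel u x e v)
    then show ?case using word_eq.cancel[of R u x e "v @ w"] by simp
  next
    case (rel l r u v)
    then show ?case using word_eq.rel[of l r R u "v @ w"] by simp
  qed (auto intro: word_eq.intros)
  show ?thesis using left[OF assms(2)] right[OF assms(1)] word_eq.trans by blast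
qed

abbreviation word_class :: "('g word \<times> 'g word) set \<Rightarrow> 'g word \<Rightarrow> 'g word set" where
  "word_class R u \<equiv> {w. word_eq R u w}"

lemma word_class_eq_iff: "word_class R u = word_class R v \<longleftrightarrow> word_eq R u v"
  by (auto intro: word_eq.intros)

lemma carrier_presented_group: "carrier (presented_group R) = range (word_class R)"
  by (auto simp: presented_group_def quotient_def)

lemma one_presented_group: "\<one>\<^bsub>presented_group R\<^esub> = word_class R []"
  by (simp add: presented_group_def)

lemma mult_presented_group:
  "word_class R u \<otimes>\<^bsub>presented_group R\<^esub> word_class R v = word_class R (u @ v)"
  by (auto simp: presented_group_def intro: word_eq.intros dest: word_eq_append)

definition inverse_word :: "'g word \<Rightarrow> 'g word" where
  "inverse_word u = rev (map (\<lambda>(x, e). (x, \<not> e)) u)"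

lemma word_eq_inverse: "word_eq R (inverse_word u @ u) []"
proof (induction u)
  case (Cons p u)
  obtain x e where p: "p = (x, e)" by force
  have "word_eq R (inverse_word u @ [(x, \<not> e), (x, \<not> \<not> e)] @ u) (inverse_word u @ u)"
    by (rule word_eq.cancel)
  then show ?case using Cons word_eq.trans by (fastforce simp: inverse_word_def p)
qed (simp add: inverse_word_def word_eq.refl)

lemma group_presented_group: "group (presented_group R)"
proof (rule groupI)
  fix X assume "X \<in> carrier (presented_group R)"
  then obtain u where "X = word_class R u" by (auto simp: carrier_presented_group)
  then have "word_class R (inverse_word u) \<otimes>\<^bsub>presented_group R\<^esub> X = \<one>\<^bsub>presented_group R\<^esub>"
    by (simp add: mult_presented_group one_presented_group word_class_eq_iff word_eq_inverse)
  then show "\<exists>Y \<in> carrier (presented_group R). Y \<otimes>\<^bsub>presented_group R\<^esub> X = \<one>\<^bsub>presented_group R\<^esub>"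
    by (auto simp: carrier_presented_group)
qed (auto simp: carrier_presented_group mult_presented_group one_presented_group)

text \<open>\<open>word_val u (k, s)\<close> gives the normal form of \<open>u a\<^sup>k b\<^sup>s\<close>.\<close>

fun word_val :: "dihedral_gen word \<Rightarrow> int \<times> bool \<Rightarrow> int \<times> bool" where
  "word_val [] p = p"
| "word_val ((GenA, e) # u) p = (let (k, s) = word_val u p in (if e then k + 1 else k - 1, s))"
| "word_val ((GenB, e) # u) p = (let (k, s) = word_val u p in (- k, \<not> s))"

lemma word_val_append: "word_val (u @ v) p = word_val u (word_val v p)"
  by (induction u p rule: word_val.induct) auto

lemma word_val_replicate:
  "word_val (replicate n (GenA, True)) p = (fst p + int n, snd p)"
  by (induction n) (auto simp: Let_def)

definition dih_eq :: "nat \<Rightarrow> int \<times> bool \<Rightarrow> int \<times> bool \<Rightarrow> bool" where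
  "dih_eq m p q \<longleftrightarrow> int m dvd fst p - fst q \<and> snd p = snd q"

lemma dih_eq_word_val: "dih_eq m p q \<Longrightarrow> dih_eq m (word_val u p) (word_val u q)"
proof (induction u)
  case (Cons x u)
  then have "int m dvd fst (word_val u p) - fst (word_val u q)"
    "snd (word_val u p) = snd (word_val u q)" by (auto simp: dih_eq_def)
  moreover from this(1) have "int m dvd fst (word_val u q) - fst (word_val u p)"
    by (simp add: dvd_diff_commute)
  ultimately show ?case
    by (cases x; cases "fst x") (auto simp: dih_eq_def Let_def split_beta)
qed simp

lemma word_eq_dih_eq:
  "word_eq (dihedral_relations m) u v \<Longrightarrow> dih_eq m (word_val u p) (word_val v p)"
proof (induction arbitrary: p rule: word_eq.induct)
  case (trans u v w)
  have "fst (word_val u p) - fst (word_val w p)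
      = (fst (word_val u p) - fst (word_val v p)) + (fst (word_val v p) - fst (word_val w p))" by simp
  then show ?case using trans.IH[of p] unfolding dih_eq_def by (metis dvd_add)
next
  case (sym u v)
  then show ?case by (simp add: dih_eq_def dvd_diff_commute)
next
  case (cancel u x e v)
  then show ?case
    by (cases x) (auto simp: word_val_append Let_def split_beta dih_eq_def)
next
  case (rel l r u v)
  then have "dih_eq m (word_val l q) (word_val r q)" for q
    by (auto simp: dihedral_relations_def word_val_replicate dih_eq_def numeral_2_eq_2 Let_def split_beta)
  then show ?case by (simp add: word_val_append dih_eq_word_val)
qed (simp add: dih_eq_def)

lemma dihedral_normal_form:
  assumes "m > 0"
  shows "\<exists>k < m. \<exists>s. word_eq (dihedral_relations m) u
           (replicate k (GenA, True) @ (if s then [(GenB, True)] else []))"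
proof -
  define R where "R = dihedral_relations m"
  interpret D: group "presented_group R" by (rule group_presented_group)
  define cl where "cl = word_class R"
  have cl_eq: "cl u = cl v \<longleftrightarrow> word_eq R u v" for u v by (simp add: cl_def word_class_eq_iff)
  have cl_mult: "cl (u @ v) = cl u \<otimes>\<^bsub>presented_group R\<^esub> cl v" for u v
    by (simp add: cl_def mult_presented_group)
  have cong: "cl (w @ u @ z) = cl (w @ v @ z)" if "cl u = cl v" for w u v z
    using that by (simp add: cl_mult)
  have am: "cl (replicate m (GenA, True)) = cl []"
    unfolding cl_eq using word_eq.rel[of "replicate m (GenA, True)" "[]" R "[]" "[]"]
    by (simp add: R_def dihedral_relations_def)
  have bb: "cl [(GenB, True), (GenB, True)] = cl []"
    unfolding cl_eq using word_eq.rel[of "replicate 2 (GenB, True)" "[]" R "[]" "[]"]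
    by (simp add: R_def dihedral_relations_def numeral_2_eq_2)
  have bab: "cl [(GenB, True), (GenA, True), (GenB, False)] = cl [(GenA, False)]"
    unfolding cl_eq using word_eq.rel[of "[(GenB, True), (GenA, True), (GenB, False)]" "[(GenA, False)]" R "[]" "[]"]
    by (simp add: R_def dihedral_relations_def)
  have canc: "cl [(x, e), (x, \<not> e)] = cl []" for x e
    unfolding cl_eq using word_eq.cancel[of R "[]" x e "[]"] by simp
  have binv: "cl [(GenB, False)] = cl [(GenB, True)]"
    using cong[OF bb, of "[(GenB, False)]" "[]"] cong[OF canc[of GenB False], of "[]" "[(GenB, True)]"] by simp
  have ainv: "cl [(GenA, False)] = cl (replicate (m - 1) (GenA, True))"
  proof -
    have "(GenA, True) # replicate (m - 1) (GenA, True) = replicate m (GenA, True)"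
      using assms by (cases m) auto
    then show ?thesis
      using cong[OF am, of "[(GenA, False)]" "[]"]
        cong[OF canc[of GenA False], of "[]" "replicate (m - 1) (GenA, True)"] by simp
  qed
  have ba: "cl [(GenB, True), (GenA, True)] = cl (replicate (m - 1) (GenA, True) @ [(GenB, True)])"
    using cong[OF bab, of "[]" "[(GenB, True)]"] cong[OF canc[of GenB False], of "[(GenB, True), (GenA, True)]" "[]"]
      cong[OF ainv, of "[]" "[(GenB, True)]"] by simp
  have bak: "\<exists>j. cl ((GenB, True) # replicate k (GenA, True)) = cl (replicate j (GenA, True) @ [(GenB, True)])" for k
  proof (induction k)
    case 0 then show ?case by (intro exI[of _ 0]) simp
  next
    case (Suc k)
    then obtain j where j: "cl ((GenB, True) # replicate k (GenA, True)) = cl (replicate j (GenA, True) @ [(GenB, True)])"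
      by blast
    have "cl ((GenB, True) # replicate (Suc k) (GenA, True))
        = cl (replicate (m - 1) (GenA, True) @ (GenB, True) # replicate k (GenA, True))"
      using cong[OF ba, of "[]" "replicate k (GenA, True)"] by simp
    also have "\<dots> = cl (replicate (m - 1 + j) (GenA, True) @ [(GenB, True)])"
      using cong[OF j, of "replicate (m - 1) (GenA, True)" "[]"] by (simp add: replicate_add)
    finally show ?case by blast
  qed
  define nf where "nf k s = replicate k (GenA, True) @ (if s then [(GenB, True)] else [])" for k s
  have ex: "\<exists>k s. cl u = cl (nf k s)" for u
  proof (induction u)
    case Nil then show ?case by (intro exI[of _ 0] exI[of _ False]) (simp add: nf_def)
  next
    case (Cons p u)
    obtain x e where p: "p = (x, e)" by force
    from Cons obtain k s where ks: "cl u = cl (nf k s)" by blast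
    have step: "cl (p # u) = cl (p # nf k s)" using cong[OF ks, of "[p]" "[]"] by simp
    show ?case
    proof (cases x)
      case GenA
      define c where "c = (if e then 1 else m - 1)"
      have "cl [p] = cl (replicate c (GenA, True))" using ainv by (simp add: p GenA c_def)
      from cong[OF this, of "[]" "nf k s"] have "cl (p # nf k s) = cl (nf (c + k) s)"
        by (simp add: nf_def replicate_add)
      with step show ?thesis by metis
    next
      case GenB
      have "cl [p] = cl [(GenB, True)]" using binv by (cases e) (simp_all add: p GenB)
      from cong[OF this, of "[]" "nf k s"] have 1: "cl (p # nf k s) = cl ((GenB, True) # nf k s)" by simp
      from bak obtain j where "cl ((GenB, True) # replicate k (GenA, True)) = cl (replicate j (GenA, True) @ [(GenB, True)])"
        by blast
      from cong[OF this, of "[]" "if s then [(GenB, True)] else []"]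
      have 2: "cl ((GenB, True) # nf k s) = cl (replicate j (GenA, True) @ (GenB, True) # (if s then [(GenB, True)] else []))"
        by (simp add: nf_def)
      have "cl (replicate j (GenA, True) @ (GenB, True) # (if s then [(GenB, True)] else [])) = cl (nf j (\<not> s))"
        using cong[OF bb, of "replicate j (GenA, True)" "[]"] by (simp add: nf_def)
      with step 1 2 show ?thesis by metis
    qed
  qed
  have red: "cl (nf (k + m * q) s) = cl (nf k s)" for k q s
  proof (induction q)
    case (Suc q)
    have "cl (nf (k + m * Suc q) s) = cl (nf (k + m * q) s)"
      using cong[OF am, of "replicate (k + m * q) (GenA, True)" "if s then [(GenB, True)] else []"]
      by (simp add: nf_def replicate_add[symmetric] algebra_simps flip: append_assoc)
    with Suc show ?case by simp
  qed simp
  from ex obtain k s where "cl u = cl (nf k s)" by blast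
  then have "cl u = cl (nf (k mod m) s)" using red[of "k mod m" "k div m" s] by simp
  then have "word_eq R u (nf (k mod m) s)" by (simp only: cl_eq)
  moreover have "k mod m < m" using assms by simp
  ultimately show ?thesis unfolding nf_def R_def by blast
qed

lemma card_dihedral_group:
  assumes "m > 0"
  shows "card (carrier (dihedral_group m)) = 2 * m"
proof -
  let ?R = "dihedral_relations m"
  define nf where "nf = (\<lambda>(k, s). replicate k (GenA, True) @ (if s then [(GenB, True)] else []))"
  have val: "word_val (nf (k, s)) (0, False) = (int k, s)" for k s
    by (auto simp: nf_def word_val_append word_val_replicate)
  have "bij_betw (\<lambda>p. word_class ?R (nf p)) ({..<m} \<times> UNIV) (carrier (dihedral_group m))"
  proof (rule bij_betw_imageI)
    show "inj_on (\<lambda>p. word_class ?R (nf p)) ({..<m} \<times> UNIV)"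
    proof (rule inj_onI, clarify)
      fix k l s t assume "k < m" "l < m" "word_class ?R (nf (k, s)) = word_class ?R (nf (l, t))"
      then have "dih_eq m (int k, s) (int l, t)"
        using word_eq_dih_eq[of m "nf (k, s)" "nf (l, t)" "(0, False)"]
        by (simp only: word_class_eq_iff val)
      then have "int m dvd int k - int l" and st: "s = t" by (auto simp: dih_eq_def)
      then have "int k mod int m = int l mod int m" by (simp add: mod_eq_dvd_iff)
      then show "k = l \<and> s = t" using \<open>k < m\<close> \<open>l < m\<close> st by simp
    qed
    show "(\<lambda>p. word_class ?R (nf p)) ` ({..<m} \<times> UNIV) = carrier (dihedral_group m)"
    proof -
      have "word_class ?R u \<in> (\<lambda>p. word_class ?R (nf p)) ` ({..<m} \<times> UNIV)" for u
      proof -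
        obtain k s where "k < m" "word_eq ?R u (nf (k, s))"
          using dihedral_normal_form[OF assms, of u] unfolding nf_def prod.case by blast
        then have "word_class ?R u = word_class ?R (nf (k, s))" by (simp only: word_class_eq_iff)
        then show ?thesis using \<open>k < m\<close> by (intro image_eqI[of _ _ "(k, s)"]) auto
      qed
      then show ?thesis unfolding dihedral_group_def carrier_presented_group by blast
    qed
  qed
  then have "card (carrier (dihedral_group m)) = card ({..<m} \<times> (UNIV :: bool set))"
    by (simp add: bij_betw_same_card)
  then show ?thesis by (simp add: card_cartesian_product)
qed

end

theory Submission
  imports Defs
begin

text \<open>The theorem holds because the non-commuting graph of \<open>G\<close> is complete multipartite with only two
different part sizes, so that both spectra can be written down.

The inverse image \<open>A\<close> in \<open>G\<close> of the rotation subgroup of \<open>D\<^sub>2\<^sub>m\<close> is generated by the centre \<open>Z\<close> and one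
further element, so it is abelian, and it has index two
(\<open>dihedral_quotient_abelian_index_two\<close>). In a non-abelian group with an abelian subgroup \<open>A\<close> of index
two, a non-central element of \<open>A\<close> commutes exactly with the elements of \<open>A\<close>, and an element \<open>x\<close>
outside \<open>A\<close> commutes exactly with \<open>Z \<union> Zx\<close> (\<open>commute_iff_same_part\<close>). The non-commuting graph is
therefore complete multipartite: one part is \<open>A - Z\<close>, with \<open>(m - 1) n\<close> vertices, and the other \<open>m\<close>
parts are the cosets of \<open>Z\<close> outside \<open>A\<close>, with \<open>n\<close> vertices each, where \<open>n = |Z|\<close> and \<open>|A| = m n\<close>.

The characteristic matrices of the adjacency and of the Laplacian matrix of a complete multipartite
graph both have diagonal entries that depend only on the part and off-diagonal entries that are
\<open>0\<close> inside a part and a constant between parts. Two applications of \<open>det (1 + A B) = det (1 + B A)\<close>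
reduce such a determinant to a product and a sum over the parts (\<open>det_multipartite\<close>). This gives
\<open>E = (m - 1) n + n sqrt ((m - 1) (5 m - 1))\<close>, whereas the Laplacian spectrum consists of \<open>0\<close>, the
number \<open>N = (2 m - 1) n\<close> of vertices, \<open>m\<close> times, and \<open>N - s\<close>, \<open>s - 1\<close> times for each part of size \<open>s\<close>.
Bounding the multiplicities \<open>(m - 1) n - 1\<close> and \<open>m (n - 1)\<close> below by \<open>m - 2\<close> and \<open>0\<close>, and the square root
above by its tangent at the argument \<open>9\<close> that belongs to \<open>m = 2\<close>, where both energies agree, turns the
claim into \<open>(m - 2)\<^sup>2 (2 m + 1) \<ge> 0\<close> (\<open>energy_inequality\<close>).\<close>

section \<open>Determinants with a multipartite pattern\<close>

text \<open>Sylvester's identity: the block matrix with rows \<open>(1, -A)\<close> and \<open>(B, 1)\<close> becomes block triangular when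
it is multiplied by either one of two unitriangular matrices, and the two results have the two sides
as their determinants.\<close>

lemma det_one_plus_mult_commute:
  fixes A B :: "'a :: idom mat"
  assumes A: "A \<in> carrier_mat n k" and B: "B \<in> carrier_mat k n"
  shows "det (1\<^sub>m n + A * B) = det (1\<^sub>m k + B * A)"
proof -
  define M where "M = four_block_mat (1\<^sub>m n) (- A) B (1\<^sub>m k)"
  define L where "L = four_block_mat (1\<^sub>m n) (0\<^sub>m n k) (- B) (1\<^sub>m k)"
  define R where "R = four_block_mat (1\<^sub>m n) A (0\<^sub>m k n) (1\<^sub>m k)"
  have carr: "M \<in> carrier_mat (n + k) (n + k)" "L \<in> carrier_mat (n + k) (n + k)"
    "R \<in> carrier_mat (n + k) (n + k)"
    by (simp_all add: M_def L_def R_def)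
  have AB: "A * B \<in> carrier_mat n n" "B * A \<in> carrier_mat k k" using A B by auto
  have "M * L = four_block_mat (1\<^sub>m n + A * B) (- A) (0\<^sub>m k n) (1\<^sub>m k)"
    unfolding M_def L_def
    by (subst mult_four_block_mat[of _ n n _ k _ k _ _ n _ k])
      (use A B AB in \<open>auto simp: left_mult_zero_mat\<close>)
  then have "det M * det L = det (1\<^sub>m n + A * B)"
    using A AB by (simp add: det_mult[OF carr(1,2), symmetric] det_four_block_mat_lower_left_zero[of _ n _ k])
  moreover have "det L = 1"
    unfolding L_def using B by (subst det_four_block_mat_upper_right_zero) auto
  moreover have "M * R = four_block_mat (1\<^sub>m n) (0\<^sub>m n k) B (1\<^sub>m k + B * A)"
    unfolding M_def R_def
    by (subst mult_four_block_mat[of _ n n _ k _ k _ _ n _ k])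
      (use A B AB in \<open>auto simp: comm_add_mat[of _ k k]\<close>)
  then have "det M * det R = det (1\<^sub>m k + B * A)"
    using B AB by (simp add: det_mult[OF carr(1,3), symmetric] det_four_block_mat_upper_right_zero[of _ n _ k])
  moreover have "det R = 1"
    unfolding R_def using A by (subst det_four_block_mat_lower_left_zero) auto
  ultimately show ?thesis by simp
qed

lemma det_diagonal:
  "det (mat n n (\<lambda>(i, j). if i = j then d i else 0)) = (\<Prod>i<n. d i)"
  for d :: "nat \<Rightarrow> 'a :: comm_ring_1"
proof -
  have "det (mat n n (\<lambda>(i, j). if i = j then d i else 0)) =
      prod_list (diag_mat (mat n n (\<lambda>(i, j). if i = j then d i else 0)))"
    by (rule det_upper_triangular[of _ n]) auto
  also have "diag_mat (mat n n (\<lambda>(i, j). if i = j then d i else 0)) = map d [0..<n]"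
    by (auto simp: diag_mat_def)
  finally show ?thesis
    by (simp add: interv_sum_list_conv_sum_set_nat prod.distinct_set_conv_list[symmetric] atLeast0LessThan)
qed

lemma det_diagonal_mult:
  fixes X :: "'a :: comm_ring_1 mat"
  assumes "X \<in> carrier_mat n n"
  shows "det (mat n n (\<lambda>(i, j). d i * X $$ (i, j))) = (\<Prod>i<n. d i) * det X"
proof -
  have "mat n n (\<lambda>(i, j). d i * X $$ (i, j)) = mat n n (\<lambda>(i, j). if i = j then d i else 0) * X"
  proof (rule eq_matI)
    fix i j assume "i < dim_row (mat n n (\<lambda>(i, j). if i = j then d i else 0) * X)"
      "j < dim_col (mat n n (\<lambda>(i, j). if i = j then d i else 0) * X)"
    then have "i < n" "j < n" using assms by auto
    then show "mat n n (\<lambda>(i, j). d i * X $$ (i, j)) $$ (i, j) =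
      (mat n n (\<lambda>(i, j). if i = j then d i else 0) * X) $$ (i, j)"
      using assms by (simp add: scalar_prod_def if_distrib[of "\<lambda>x. x * _"] sum.delta cong: if_cong)
  qed (use assms in auto)
  then show ?thesis
    using assms by (simp add: det_mult[of _ n] det_diagonal)
qed

text \<open>After the diagonal factor is pulled out, Sylvester's identity turns the remaining
determinant into a \<open>1 \<times> 1\<close> determinant.\<close>

lemma det_diagonal_plus_rank_one:
  fixes d v :: "nat \<Rightarrow> 'a :: field"
  assumes d: "\<And>p. p < k \<Longrightarrow> d p \<noteq> 0"
  shows "det (mat k k (\<lambda>(p, q). (if p = q then d p else 0) + v p)) =
    (\<Prod>p<k. d p) * (1 + (\<Sum>p<k. v p / d p))"
proof -
  define u where "u = mat k 1 (\<lambda>(p, q). v p / d p)"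
  define w where "w = mat 1 k (\<lambda>_. 1 :: 'a)"
  have uw: "u \<in> carrier_mat k 1" "w \<in> carrier_mat 1 k" by (auto simp: u_def w_def)
  have "mat k k (\<lambda>(p, q). (if p = q then d p else 0) + v p) =
    mat k k (\<lambda>(p, q). d p * (1\<^sub>m k + u * w) $$ (p, q))"
    using d by (intro eq_matI) (auto simp: u_def w_def scalar_prod_def field_simps)
  also have "det \<dots> = (\<Prod>p<k. d p) * det (1\<^sub>m k + u * w)"
    by (rule det_diagonal_mult) (use uw in auto)
  also have "det (1\<^sub>m k + u * w) = det (1\<^sub>m 1 + w * u)"
    by (rule det_one_plus_mult_commute[OF uw])
  also have "1\<^sub>m 1 + w * u = mat 1 1 (\<lambda>(i, j). if i = j then 1 + (\<Sum>p<k. v p / d p) else 0)"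
    by (rule eq_matI) (auto simp: u_def w_def scalar_prod_def atLeast0LessThan)
  also have "det \<dots> = 1 + (\<Sum>p<k. v p / d p)"
    by (subst det_diagonal) simp
  finally show ?thesis .
qed

text \<open>After division of row \<open>i\<close> by \<open>\<delta> (f (vs ! i))\<close> the matrix is \<open>1 + A B\<close>, where \<open>B\<close> is the incidence matrix
between parts and vertices. The product \<open>B A\<close> has one row and one column per part, and \<open>1 + B A\<close> is a
diagonal matrix plus a rank one matrix. With \<open>\<delta> = x\<close> and \<open>c = -1\<close> this evaluates the characteristic
polynomial of the adjacency matrix at \<open>x\<close>; with \<open>\<delta>\<close> equal to \<open>x\<close> minus the degree and \<open>c = 1\<close> it does
so for the Laplacian matrix.\<close>

lemma det_multipartite:
  fixes \<delta> :: "'b \<Rightarrow> 'c :: field" and f :: "'a \<Rightarrow> 'b"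
  assumes vs: "distinct vs"
    and \<delta>: "\<And>p. p \<in> f ` set vs \<Longrightarrow> \<delta> p \<noteq> 0"
      "\<And>p. p \<in> f ` set vs \<Longrightarrow> \<delta> p \<noteq> c * of_nat (card {x \<in> set vs. f x = p})"
  defines "s \<equiv> \<lambda>p. card {x \<in> set vs. f x = p}"
  shows "det (mat (length vs) (length vs)
      (\<lambda>(i, j). if i = j then \<delta> (f (vs ! i)) else if f (vs ! i) = f (vs ! j) then 0 else c)) =
    (\<Prod>p\<in>f ` set vs. \<delta> p ^ (s p - 1) * (\<delta> p - c * of_nat (s p))) *
    (1 + c * (\<Sum>p\<in>f ` set vs. of_nat (s p) / (\<delta> p - c * of_nat (s p))))"
proof -
  define N where "N = length vs"
  define P where "P = f ` set vs"
  define g where "g i = f (vs ! i)" for i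
  define k where "k = card P"
  have finP: "finite P" by (simp add: P_def)
  obtain e where e: "bij_betw e {..<k} P"
    using ex_bij_betw_nat_finite[OF finP] unfolding k_def atLeast0LessThan by blast
  have nth: "bij_betw ((!) vs) {..<N} (set vs)"
    by (rule bij_betw_nth) (auto simp: N_def vs)
  have e_inj: "e p = e q \<longleftrightarrow> p = q" if "p < k" "q < k" for p q
    using e that by (auto simp: bij_betw_def inj_on_def)
  have e_in: "e p \<in> P" if "p < k" for p using e that by (auto simp: bij_betw_def)
  have g_in: "g i \<in> P" if "i < N" for i using that by (auto simp: g_def P_def N_def)
  have s_nonzero: "s p > 0" if "p \<in> P" for p
    using that by (auto simp: s_def P_def card_gt_0_iff)
  have dP: "\<delta> p \<noteq> 0" "\<delta> p \<noteq> c * of_nat (s p)" if "p \<in> P" for p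
    using \<delta> that by (auto simp: P_def s_def)
  have s_sum: "(\<Sum>i<N. if g i = p then y else 0) = of_nat (s p) * y" for p and y :: 'c
  proof -
    have "(\<Sum>i<N. if g i = p then y else 0) = (\<Sum>x\<in>set vs. if f x = p then y else 0)"
      unfolding g_def by (rule sum.reindex_bij_betw[OF nth])
    then show ?thesis by (simp add: s_def sum.If_cases Int_def conj_commute)
  qed
  define A where "A = mat N k (\<lambda>(i, q). if g i = e q then 0 else c / \<delta> (g i))"
  define B where "B = mat k N (\<lambda>(q, j). if g j = e q then 1 else 0 :: 'c)"
  have AB: "A \<in> carrier_mat N k" "B \<in> carrier_mat k N" by (auto simp: A_def B_def)
  have ABij: "(A * B) $$ (i, j) = (if g i = g j then 0 else c / \<delta> (g i))" if ij: "i < N" "j < N" for i j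
  proof -
    obtain q where q: "q < k" "e q = g j" using e g_in[OF ij(2)] by (auto simp: bij_betw_def)
    have "(A * B) $$ (i, j) =
      (\<Sum>r<k. (if g i = e r then 0 else c / \<delta> (g i)) * (if g j = e r then 1 else 0))"
      using ij by (simp add: A_def B_def scalar_prod_def atLeast0LessThan)
    also have "\<dots> = (\<Sum>r<k. if r = q then (if g i = g j then 0 else c / \<delta> (g i)) else 0)"
      using q e_inj by (intro sum.cong) auto
    finally have "(A * B) $$ (i, j) = \<dots>" .
    then show ?thesis using q by simp
  qed
  have BAij: "(B * A) $$ (p, q) = (if p = q then 0 else c * of_nat (s (e p)) / \<delta> (e p))"
    if "p < k" "q < k" for p q
  proof -
    have "(B * A) $$ (p, q) =
      (\<Sum>i<N. (if g i = e p then 1 else 0) * (if g i = e q then 0 else c / \<delta> (g i)))"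
      using that by (simp add: A_def B_def scalar_prod_def atLeast0LessThan)
    also have "\<dots> = (\<Sum>i<N. if g i = e p then (if p = q then 0 else c / \<delta> (e p)) else 0)"
      using that e_inj by (intro sum.cong) auto
    finally show ?thesis by (simp add: s_sum)
  qed
  have "mat N N (\<lambda>(i, j). if i = j then \<delta> (g i) else if g i = g j then 0 else c) =
    mat N N (\<lambda>(i, j). \<delta> (g i) * (1\<^sub>m N + A * B) $$ (i, j))"
    using AB dP(1)[OF g_in] by (intro eq_matI) (auto simp: ABij simp del: index_mult_mat(1))
  also have "det \<dots> = (\<Prod>i<N. \<delta> (g i)) * det (1\<^sub>m N + A * B)"
    by (rule det_diagonal_mult) (use AB in auto)
  also have "(\<Prod>i<N. \<delta> (g i)) = (\<Prod>p\<in>P. \<delta> p ^ s p)"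
  proof -
    have "(\<Prod>i<N. \<delta> (g i)) = (\<Prod>x\<in>set vs. \<delta> (f x))"
      unfolding g_def by (rule prod.reindex_bij_betw[OF nth])
    also have "\<dots> = (\<Prod>p\<in>P. \<Prod>x\<in>{x \<in> set vs. f x = p}. \<delta> (f x))"
      unfolding P_def by (rule prod.image_gen) simp
    also have "\<dots> = (\<Prod>p\<in>P. \<delta> p ^ s p)"
      by (intro prod.cong) (auto simp: s_def)
    finally show ?thesis .
  qed
  also have "det (1\<^sub>m N + A * B) = det (1\<^sub>m k + B * A)"
    by (rule det_one_plus_mult_commute[OF AB])
  also have "1\<^sub>m k + B * A = mat k k (\<lambda>(p, q).
      (if p = q then (\<delta> (e p) - c * of_nat (s (e p))) / \<delta> (e p) else 0) + c * of_nat (s (e p)) / \<delta> (e p))"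
    using AB dP(1)[OF e_in] by (intro eq_matI) (auto simp: BAij diff_divide_distrib simp del: index_mult_mat(1))
  also have "det \<dots> = (\<Prod>p<k. (\<delta> (e p) - c * of_nat (s (e p))) / \<delta> (e p)) *
      (1 + (\<Sum>p<k. (c * of_nat (s (e p)) / \<delta> (e p)) / ((\<delta> (e p) - c * of_nat (s (e p))) / \<delta> (e p))))"
    by (rule det_diagonal_plus_rank_one) (use dP e_in in auto)
  also have "(\<Prod>p<k. (\<delta> (e p) - c * of_nat (s (e p))) / \<delta> (e p)) =
      (\<Prod>p\<in>P. (\<delta> p - c * of_nat (s p)) / \<delta> p)"
    by (rule prod.reindex_bij_betw[OF e])
  also have "(\<Sum>p<k. (c * of_nat (s (e p)) / \<delta> (e p)) / ((\<delta> (e p) - c * of_nat (s (e p))) / \<delta> (e p))) =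
      (\<Sum>p\<in>P. (c * of_nat (s p) / \<delta> p) / ((\<delta> p - c * of_nat (s p)) / \<delta> p))"
    by (rule sum.reindex_bij_betw[OF e])
  also have "\<dots> = c * (\<Sum>p\<in>P. of_nat (s p) / (\<delta> p - c * of_nat (s p)))"
    unfolding sum_distrib_left using dP by (intro sum.cong) auto
  finally have "det (mat N N (\<lambda>(i, j). if i = j then \<delta> (g i) else if g i = g j then 0 else c)) =
    (\<Prod>p\<in>P. \<delta> p ^ s p * ((\<delta> p - c * of_nat (s p)) / \<delta> p)) *
    (1 + c * (\<Sum>p\<in>P. of_nat (s p) / (\<delta> p - c * of_nat (s p))))"
    by (simp only: prod.distrib mult.assoc)
  moreover have "(\<Prod>p\<in>P. \<delta> p ^ s p * ((\<delta> p - c * of_nat (s p)) / \<delta> p)) =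
    (\<Prod>p\<in>P. \<delta> p ^ (s p - 1) * (\<delta> p - c * of_nat (s p)))"
  proof (rule prod.cong)
    fix p assume p: "p \<in> P"
    then have "\<delta> p ^ s p = \<delta> p * \<delta> p ^ (s p - 1)"
      using s_nonzero[OF p] by (simp flip: power_Suc)
    then show "\<delta> p ^ s p * ((\<delta> p - c * of_nat (s p)) / \<delta> p) =
      \<delta> p ^ (s p - 1) * (\<delta> p - c * of_nat (s p))"
      using dP(1)[OF p] by simp
  qed simp
  ultimately show ?thesis by (simp only: N_def g_def P_def)
qed

text \<open>The determinant formula needs finitely many values of \<open>x\<close> to be excluded, so equality of
characteristic polynomials is deduced from equality of their values elsewhere.\<close>

lemma poly_eq_off_finite:
  fixes p q :: "'a :: {idom, ring_char_0} poly"
  assumes "finite S" and "\<And>x. x \<notin> S \<Longrightarrow> poly p x = poly q x"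
  shows "p = q"
proof (rule ccontr)
  assume "p \<noteq> q"
  then have "finite {x. poly (p - q) x = 0}" by (intro poly_roots_finite) simp
  moreover have "UNIV - S \<subseteq> {x. poly (p - q) x = 0}" using assms(2) by auto
  ultimately have "finite (UNIV :: 'a set)" using assms(1) by (meson finite_Diff2 finite_subset)
  then show False by (simp add: infinite_UNIV_char_0)
qed

section \<open>Spectra of complete multipartite graphs\<close>

locale complete_multipartite =
  fixes \<Gamma> :: "'a ugraph" and f :: "'a \<Rightarrow> 'b"
  assumes finite_verts: "finite (verts \<Gamma>)"
    and edges_eq: "edges \<Gamma> = {{x, y} | x y. x \<in> verts \<Gamma> \<and> y \<in> verts \<Gamma> \<and> f x \<noteq> f y}"
begin

definition parts :: "'b set" where
  "parts = f ` verts \<Gamma>"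

definition part_size :: "'b \<Rightarrow> nat" where
  "part_size p = card {x \<in> verts \<Gamma>. f x = p}"

lemma edge_iff: "{x, y} \<in> edges \<Gamma> \<longleftrightarrow> x \<in> verts \<Gamma> \<and> y \<in> verts \<Gamma> \<and> f x \<noteq> f y"
  by (auto simp: edges_eq doubleton_eq_iff)

lemma finite_parts: "finite parts"
  by (simp add: parts_def finite_verts)

lemma part_size_pos: "p \<in> parts \<Longrightarrow> part_size p > 0"
  by (auto simp: part_size_def parts_def card_gt_0_iff finite_verts)

lemma sum_verts_by_part: "(\<Sum>x\<in>verts \<Gamma>. g (f x)) = (\<Sum>p\<in>parts. of_nat (part_size p) * g p)"
  for g :: "'b \<Rightarrow> 'd :: semiring_1"
  unfolding parts_def by (subst sum.image_gen[OF finite_verts, of _ f]) (simp add: part_size_def)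

lemma card_verts_by_part: "card (verts \<Gamma>) = (\<Sum>p\<in>parts. part_size p)"
  using sum_verts_by_part[of "\<lambda>_. 1 :: nat"] by simp

lemma finite_edges: "finite (edges \<Gamma>)"
  by (rule finite_subset[of _ "Pow (verts \<Gamma>)"]) (auto simp: edges_eq finite_verts)

text \<open>Stated as a sum so that no truncated subtraction occurs.\<close>

lemma degree_of_plus_part_size:
  assumes x: "x \<in> verts \<Gamma>"
  shows "degree_of \<Gamma> x + part_size (f x) = card (verts \<Gamma>)"
proof -
  have "bij_betw (\<lambda>y. {x, y}) {y \<in> verts \<Gamma>. f y \<noteq> f x} {e \<in> edges \<Gamma>. x \<in> e}"
  proof (rule bij_betw_imageI)
    show "inj_on (\<lambda>y. {x, y}) {y \<in> verts \<Gamma>. f y \<noteq> f x}"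
      by (auto simp: inj_on_def doubleton_eq_iff)
    show "(\<lambda>y. {x, y}) ` {y \<in> verts \<Gamma>. f y \<noteq> f x} = {e \<in> edges \<Gamma>. x \<in> e}"
      using x by (auto simp: edges_eq image_iff)
  qed
  then have "degree_of \<Gamma> x = card {y \<in> verts \<Gamma>. f y \<noteq> f x}"
    by (simp add: degree_of_def bij_betw_same_card)
  moreover have "card ({y \<in> verts \<Gamma>. f y \<noteq> f x} \<union> {y \<in> verts \<Gamma>. f y = f x}) =
      card {y \<in> verts \<Gamma>. f y \<noteq> f x} + card {y \<in> verts \<Gamma>. f y = f x}"
    by (rule card_Un_disjoint) (auto simp: finite_verts)
  moreover have "{y \<in> verts \<Gamma>. f y \<noteq> f x} \<union> {y \<in> verts \<Gamma>. f y = f x} = verts \<Gamma>" by auto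
  ultimately show ?thesis by (simp add: part_size_def)
qed

lemma sum_degrees: "(\<Sum>x\<in>verts \<Gamma>. degree_of \<Gamma> x) = 2 * card (edges \<Gamma>)"
  unfolding degree_of_def
proof (rule sum_multicount)
  show "\<forall>e\<in>edges \<Gamma>. card {x \<in> verts \<Gamma>. x \<in> e} = 2"
  proof
    fix e assume "e \<in> edges \<Gamma>"
    then obtain x y where "e = {x, y}" "x \<in> verts \<Gamma>" "y \<in> verts \<Gamma>" "f x \<noteq> f y"
      by (auto simp: edges_eq)
    moreover from this have "{z \<in> verts \<Gamma>. z \<in> e} = {x, y}" "x \<noteq> y" by auto
    ultimately show "card {x \<in> verts \<Gamma>. x \<in> e} = 2" by auto
  qed
qed (auto simp: finite_verts finite_edges)

lemma two_card_edges:
  "2 * card (edges \<Gamma>) = (\<Sum>p\<in>parts. part_size p * (card (verts \<Gamma>) - part_size p))"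
proof -
  have "2 * card (edges \<Gamma>) = (\<Sum>x\<in>verts \<Gamma>. card (verts \<Gamma>) - part_size (f x))"
    unfolding sum_degrees[symmetric]
    using degree_of_plus_part_size by (intro sum.cong) (auto simp flip: degree_of_plus_part_size)
  then show ?thesis
    using sum_verts_by_part[of "\<lambda>p. card (verts \<Gamma>) - part_size p"] by simp
qed

lemma distinct_enum: "distinct (vertex_enum \<Gamma>)"
  and set_enum: "set (vertex_enum \<Gamma>) = verts \<Gamma>"
  using vertex_enum[OF finite_verts] by auto

lemma poly_char_poly_adjacency:
  assumes x: "x \<noteq> 0" "\<And>p. p \<in> parts \<Longrightarrow> x + of_nat (part_size p) \<noteq> 0"
  shows "poly (char_poly (adjacency_matrix \<Gamma>)) x =
    (\<Prod>p\<in>parts. x ^ (part_size p - 1) * (x + of_nat (part_size p))) *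
    (1 - (\<Sum>p\<in>parts. of_nat (part_size p) / (x + of_nat (part_size p))))"
proof -
  define vs where "vs = vertex_enum \<Gamma>"
  have vs: "distinct vs" "set vs = verts \<Gamma>" by (simp_all add: vs_def distinct_enum set_enum)
  have A: "adjacency_matrix \<Gamma> \<in> carrier_mat (length vs) (length vs)"
    by (simp add: adjacency_matrix_def vs_def Let_def)
  have "poly (char_poly (adjacency_matrix \<Gamma>)) x =
    det (mat (length vs) (length vs)
      (\<lambda>(i, j). if i = j then x else if f (vs ! i) = f (vs ! j) then 0 else - 1))"
    unfolding char_poly_matrix[OF A]
    by (rule arg_cong[of _ _ det], rule eq_matI)
      (use vs in \<open>auto simp: char_matrix_def adjacency_matrix_def Let_def edge_iff vs_def[symmetric]\<close>)
  also have "\<dots> = (\<Prod>p\<in>parts. x ^ (part_size p - 1) * (x + of_nat (part_size p))) *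
    (1 - (\<Sum>p\<in>parts. of_nat (part_size p) / (x + of_nat (part_size p))))"
    using det_multipartite[OF vs(1), of f "\<lambda>_. x" "- 1"] x
    by (simp add: vs(2) parts_def part_size_def eq_neg_iff_add_eq_0)
  finally show ?thesis .
qed

text \<open>The vertices of a part of size \<open>s\<close> have degree \<open>N - s\<close>, so the second factor \<open>\<delta> - c s\<close> that
\<open>det_multipartite\<close> attaches to a part is \<open>x - N\<close>, whatever the part. This is why the Laplacian spectrum has a closed form for
arbitrary part sizes, unlike the adjacency spectrum.\<close>

lemma poly_char_poly_laplacian:
  fixes x :: complex
  defines "N \<equiv> of_nat (card (verts \<Gamma>))"
  assumes x: "x \<noteq> N" "\<And>p. p \<in> parts \<Longrightarrow> x \<noteq> N - of_nat (part_size p)"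
  shows "poly (char_poly (laplacian_matrix \<Gamma>)) x =
    (\<Prod>p\<in>parts. (x - (N - of_nat (part_size p))) ^ (part_size p - 1) * (x - N)) * (1 + N / (x - N))"
proof -
  define vs where "vs = vertex_enum \<Gamma>"
  define \<delta> where "\<delta> p = x - (N - of_nat (part_size p))" for p
  have vs: "distinct vs" "set vs = verts \<Gamma>" by (simp_all add: vs_def distinct_enum set_enum)
  have in_verts: "vs ! i \<in> verts \<Gamma>" if "i < length vs" for i
    using nth_mem[OF that] vs(2) by simp
  have deg: "of_nat (degree_of \<Gamma> y) = N - of_nat (part_size (f y))" if "y \<in> verts \<Gamma>" for y
    using arg_cong[OF degree_of_plus_part_size[OF that], of "of_nat :: nat \<Rightarrow> complex"]
    by (simp add: N_def eq_diff_eq)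
  have A: "laplacian_matrix \<Gamma> \<in> carrier_mat (length vs) (length vs)"
    unfolding laplacian_matrix_def
    by (rule minus_carrier_mat) (simp add: adjacency_matrix_def vs_def Let_def)
  have "poly (char_poly (laplacian_matrix \<Gamma>)) x =
    det (mat (length vs) (length vs)
      (\<lambda>(i, j). if i = j then \<delta> (f (vs ! i)) else if f (vs ! i) = f (vs ! j) then 0 else 1))"
    unfolding char_poly_matrix[OF A]
    by (rule arg_cong[of _ _ det], rule eq_matI)
      (use in_verts deg in \<open>auto simp: char_matrix_def laplacian_matrix_def adjacency_matrix_def
        degree_matrix_def Let_def edge_iff vs_def[symmetric] \<delta>_def\<close>)
  also have "\<dots> = (\<Prod>p\<in>parts. \<delta> p ^ (part_size p - 1) * (x - N)) *
      (1 + (\<Sum>p\<in>parts. of_nat (part_size p) / (x - N)))"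
    using det_multipartite[OF vs(1), of f \<delta> 1] x
    by (simp add: vs(2) parts_def[symmetric] part_size_def[symmetric] \<delta>_def diff_diff_eq2 eq_diff_eq add.commute)
  also have "(\<Sum>p\<in>parts. of_nat (part_size p) / (x - N)) = N / (x - N)"
    by (simp add: N_def card_verts_by_part sum_divide_distrib)
  finally show ?thesis by (simp add: \<delta>_def)
qed

lemma eigenvalues_laplacian:
  assumes nonempty: "verts \<Gamma> \<noteq> {}"
  defines "N \<equiv> of_nat (card (verts \<Gamma>))"
  shows "eigenvalues (laplacian_matrix \<Gamma>) =
    {#0#} + replicate_mset (card parts - 1) N +
    (\<Sum>p\<in>parts. replicate_mset (part_size p - 1) (N - of_nat (part_size p)))"
proof -
  have card_parts: "card parts = Suc (card parts - 1)"
    using nonempty finite_parts by (simp add: parts_def card_gt_0_iff)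
  define S where "S = insert N ((\<lambda>p. N - of_nat (part_size p)) ` parts)"
  define Q where "Q = (\<Prod>p\<in>parts. [:- (N - of_nat (part_size p)), 1:] ^ (part_size p - 1))"
  have char: "char_poly (laplacian_matrix \<Gamma>) = [:- 0, 1:] * [:- N, 1:] ^ (card parts - 1) * Q"
  proof (rule poly_eq_off_finite)
    show "finite S" by (simp add: S_def finite_parts)
    fix x assume x: "x \<notin> S"
    then have xN: "x \<noteq> N" by (simp add: S_def)
    have poly_Q: "poly Q x = (\<Prod>p\<in>parts. (x - (N - of_nat (part_size p))) ^ (part_size p - 1))"
      by (simp add: Q_def poly_prod algebra_simps)
    have "poly (char_poly (laplacian_matrix \<Gamma>)) x = poly Q x * ((x - N) ^ card parts * (1 + N / (x - N)))"
    proof -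
      have "x \<noteq> N - of_nat (part_size p)" if "p \<in> parts" for p
        using x that by (auto simp: S_def)
      from poly_char_poly_laplacian[of x, folded N_def, OF xN this] show ?thesis
        by (simp only: prod.distrib prod_constant poly_Q mult.assoc)
    qed
    also have "(x - N) ^ card parts * (1 + N / (x - N)) = (x - N) ^ (card parts - 1) * x"
      using xN by (subst card_parts) (simp add: field_simps)
    finally show "poly (char_poly (laplacian_matrix \<Gamma>)) x =
        poly ([:- 0, 1:] * [:- N, 1:] ^ (card parts - 1) * Q) x"
      by (simp add: algebra_simps)
  qed
  have Q: "Q \<noteq> 0" by (auto simp: Q_def finite_parts)
  have "proots Q = (\<Sum>p\<in>parts. replicate_mset (part_size p - 1) (N - of_nat (part_size p)))"
    unfolding Q_def by (subst proots_prod) (auto simp: finite_parts proots_power)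
  then show ?thesis
    unfolding eigenvalues_def char using Q
    by (simp add: proots_mult proots_power del: mult_pCons_left)
qed

lemma laplacian_energy_eq:
  assumes nonempty: "verts \<Gamma> \<noteq> {}"
  defines "N \<equiv> real (card (verts \<Gamma>))" and "d \<equiv> 2 * real (card (edges \<Gamma>)) / real (card (verts \<Gamma>))"
  shows "laplacian_energy \<Gamma> = d + real (card parts - 1) * \<bar>N - d\<bar> +
    (\<Sum>p\<in>parts. real (part_size p - 1) * \<bar>N - real (part_size p) - d\<bar>)"
proof -
  have d: "2 * of_nat (card (edges \<Gamma>)) / of_nat (card (verts \<Gamma>)) = complex_of_real d"
    by (simp add: d_def)
  have "d \<ge> 0" by (simp add: d_def)
  have N: "of_nat (card (verts \<Gamma>)) = complex_of_real N" by (simp add: N_def)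
  have norm: "cmod (complex_of_real N - complex_of_real d) = \<bar>N - d\<bar>"
    "cmod (complex_of_real N - of_nat k - complex_of_real d) = \<bar>N - real k - d\<bar>" for k
    by (metis of_real_diff norm_of_real of_real_of_nat_eq)+
  have sum: "(\<Sum>x\<in>#(\<Sum>p\<in>P. M p). h x) = (\<Sum>p\<in>P. \<Sum>x\<in>#M p. h x)"
    for P :: "'b set" and M and h :: "complex \<Rightarrow> real"
    by (induction P rule: infinite_finite_induct) auto
  show ?thesis
    unfolding laplacian_energy_def eigenvalues_laplacian[OF nonempty] d unfolding N
    using \<open>d \<ge> 0\<close> by (simp add: sum norm)
qed

text \<open>When one part has size \<open>a\<close> and the \<open>r\<close> others size \<open>b\<close>, the part of the characteristic polynomial that
does not come from repeated factors \<open>x\<close> and \<open>x + b\<close> is the quadratic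
\<open>x\<^sup>2 - (r - 1) b x - r a b\<close>, whose roots are the last two eigenvalues listed.\<close>

lemma eigenvalues_adjacency_two_sizes:
  assumes p0: "p0 \<in> parts"
    and sizes: "part_size p0 = a" "\<And>p. p \<in> parts - {p0} \<Longrightarrow> part_size p = b"
    and r: "card parts = Suc r" "r > 0"
  defines "s \<equiv> sqrt ((real (r - 1) * b)\<^sup>2 + 4 * real r * a * b)"
  shows "eigenvalues (adjacency_matrix \<Gamma>) =
    replicate_mset (a - 1 + r * (b - 1)) 0 + replicate_mset (r - 1) (- of_nat b) +
    {# of_real ((real (r - 1) * b + s) / 2), of_real ((real (r - 1) * b - s) / 2) #}"
proof -
  define t where "t = real (r - 1) * b"
  define u where "u = (t + s) / 2"
  define v where "v = (t - s) / 2"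
  have "s\<^sup>2 = t\<^sup>2 + 4 * real r * a * b"
    unfolding s_def t_def by (rule real_sqrt_pow2) auto
  then have uv: "u + v = t" "u * v = - (real r * a * b)"
    by (simp_all add: u_def v_def field_simps power2_eq_square)
  have fin: "finite (parts - {p0})" and rest: "card (parts - {p0}) = r"
    using finite_parts p0 r by simp_all
  have parts: "parts = insert p0 (parts - {p0})" using p0 by blast
  define S where "S = {0, - of_nat a, - of_nat b :: complex}"
  have char: "char_poly (adjacency_matrix \<Gamma>) =
    [:- 0, 1:] ^ (a - 1 + r * (b - 1)) * [:- (- of_nat b), 1:] ^ (r - 1) *
    ([:- of_real u, 1:] * [:- of_real v, 1:])"
  proof (rule poly_eq_off_finite)
    show "finite S" by (simp add: S_def)
    fix x assume x: "x \<notin> S"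
    then have x0: "x \<noteq> 0" "x + of_nat a \<noteq> 0" "x + of_nat b \<noteq> 0"
      by (auto simp: S_def eq_neg_iff_add_eq_0)
    have "x + of_nat (part_size p) \<noteq> 0" if "p \<in> parts" for p
      using that x0 sizes by (cases "p = p0") auto
    note poly_char_poly_adjacency[OF x0(1) this]
    also have "(\<Prod>p\<in>parts. x ^ (part_size p - 1) * (x + of_nat (part_size p))) =
      x ^ (a - 1) * (x + of_nat a) * (x ^ (b - 1) * (x + of_nat b)) ^ r"
      by (subst parts, subst prod.insert) (use fin sizes rest in auto)
    also have "(\<Sum>p\<in>parts. of_nat (part_size p) / (x + of_nat (part_size p))) =
      of_nat a / (x + of_nat a) + of_nat r * (of_nat b / (x + of_nat b))"
      by (subst parts, subst sum.insert) (use fin sizes rest in auto)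
    also have "x ^ (a - 1) * (x + of_nat a) * (x ^ (b - 1) * (x + of_nat b)) ^ r *
        (1 - (of_nat a / (x + of_nat a) + of_nat r * (of_nat b / (x + of_nat b)))) =
      x ^ (a - 1 + r * (b - 1)) * (x + of_nat b) ^ (r - 1) *
        (x\<^sup>2 - of_nat (r - 1) * of_nat b * x - of_nat r * of_nat a * of_nat b)"
    proof -
      have "(x + of_nat a) * (x + of_nat b) *
          (1 - (of_nat a / (x + of_nat a) + of_nat r * (of_nat b / (x + of_nat b)))) =
        x\<^sup>2 - of_nat (r - 1) * of_nat b * x - of_nat r * of_nat a * of_nat b"
      proof -
        have cancel: "X * Y * (1 - (\<alpha> / X + \<rho> * (\<beta> / Y))) = X * Y - \<alpha> * Y - \<rho> * \<beta> * X"
          if "X \<noteq> 0" "Y \<noteq> 0" for X Y \<alpha> \<beta> \<rho> :: complex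
          using that by (simp add: field_simps)
        show ?thesis
          unfolding cancel[OF x0(2,3)] using r(2)
          by (simp add: algebra_simps of_nat_diff power2_eq_square)
      qed
      moreover have "(x + of_nat b) ^ r = (x + of_nat b) ^ (r - 1) * (x + of_nat b)"
        using r(2) by (simp flip: power_Suc2)
      ultimately show ?thesis
        by (simp add: power_add power_mult_distrib power_mult[symmetric] mult.commute[of r] mult.assoc mult.left_commute)
    qed
    also have "x\<^sup>2 - of_nat (r - 1) * of_nat b * x - of_nat r * of_nat a * of_nat b =
      (x - of_real u) * (x - of_real v)"
    proof -
      have "(x - of_real u) * (x - of_real v) = x\<^sup>2 - of_real (u + v) * x + of_real (u * v)"
        by (simp add: algebra_simps power2_eq_square)
      then show ?thesis by (simp add: uv t_def)
    qed
    finally show "poly (char_poly (adjacency_matrix \<Gamma>)) x =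
        poly ([:- 0, 1:] ^ (a - 1 + r * (b - 1)) * [:- (- of_nat b), 1:] ^ (r - 1) *
          ([:- of_real u, 1:] * [:- of_real v, 1:])) x"
      by (simp add: algebra_simps)
  qed
  have "proots ([:- 0, 1:] ^ (a - 1 + r * (b - 1)) * [:- (- of_nat b), 1:] ^ (r - 1) *
      ([:- of_real u, 1:] * [:- of_real v, 1:])) =
    replicate_mset (a - 1 + r * (b - 1)) 0 + replicate_mset (r - 1) (- of_nat b) +
      {# complex_of_real u, complex_of_real v #}"
    by (subst proots_mult, (simp; fail), (simp; fail))+
      (simp add: proots_mult proots_power del: mult_pCons_left mult_pCons_right)
  then show ?thesis by (simp only: eigenvalues_def char u_def v_def t_def)
qed

text \<open>The two roots of the quadratic have opposite signs, so their absolute values add up to the square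
root of the discriminant.\<close>

lemma energy_two_sizes:
  assumes "p0 \<in> parts"
    and "part_size p0 = a" "\<And>p. p \<in> parts - {p0} \<Longrightarrow> part_size p = b"
    and "card parts = Suc r" "r > 0"
  shows "energy \<Gamma> = real (r - 1) * b + sqrt ((real (r - 1) * b)\<^sup>2 + 4 * real r * a * b)"
proof -
  define t where "t = real (r - 1) * b"
  define s where "s = sqrt (t\<^sup>2 + 4 * real r * a * b)"
  have "t \<ge> 0" by (simp add: t_def)
  moreover have "s \<ge> t" unfolding s_def by (rule real_le_rsqrt) simp
  ultimately have "\<bar>(t + s) / 2\<bar> + \<bar>(t - s) / 2\<bar> = s" by (simp add: abs_if field_simps)
  then have "cmod (complex_of_real ((t + s) / 2)) + cmod (complex_of_real ((t - s) / 2)) = s"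
    by (simp only: norm_of_real)
  moreover have "energy \<Gamma> = real (r - 1) * b +
      (cmod (complex_of_real ((t + s) / 2)) + cmod (complex_of_real ((t - s) / 2)))"
    unfolding energy_def s_def t_def
    by (subst eigenvalues_adjacency_two_sizes[OF assms])
      (simp_all del: of_real_divide of_real_add of_real_diff)
  ultimately show ?thesis by (simp add: s_def t_def)
qed

end


section \<open>Comparison of the two energies for dihedral part sizes\<close>

text \<open>The two sides are the energy and the Laplacian energy of the complete multipartite graph with one
part of size \<open>(m - 1) n\<close> and \<open>m\<close> parts of size \<open>n\<close>; \<open>N\<close> is its number of vertices and \<open>d\<close> its average
degree. All quantities on the right become polynomials in \<open>m\<close> and \<open>n\<close> times \<open>e = n / (2 m - 1)\<close>.
Since \<open>n \<ge> 1\<close>, the multiplicity \<open>(m - 1) n - 1\<close> is at least \<open>m - 2\<close>, and the last summand may be dropped.\<close>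

lemma energy_inequality:
  fixes m n :: real
  assumes m: "m \<ge> 2" and n: "n \<ge> 1"
  defines "N \<equiv> (2 * m - 1) * n" and "d \<equiv> 3 * m * (m - 1) * n / (2 * m - 1)"
  shows "(m - 1) * n + sqrt (((m - 1) * n)\<^sup>2 + 4 * m * ((m - 1) * n) * n) \<le>
    d + m * \<bar>N - d\<bar> + (((m - 1) * n - 1) * \<bar>N - (m - 1) * n - d\<bar> + m * ((n - 1) * \<bar>N - n - d\<bar>))"
proof -
  define e where "e = n / (2 * m - 1)"
  have e: "e > 0" "n = e * (2 * m - 1)" using m n by (simp_all add: e_def)
  have d: "d = e * (3 * m * (m - 1))" by (simp add: d_def e_def)
  have "N - d = e * (m * (m - 1) + 1)"
    "N - (m - 1) * n - d = - (e * (m * (m - 2)))"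
    "N - n - d = e * ((m - 1) * (m - 2))"
    unfolding N_def d e(2) by (simp_all add: algebra_simps)
  then have abs: "\<bar>N - d\<bar> = e * (m * (m - 1) + 1)"
    "\<bar>N - (m - 1) * n - d\<bar> = e * (m * (m - 2))"
    "\<bar>N - n - d\<bar> = e * ((m - 1) * (m - 2))"
    using e(1) m by (simp_all add: abs_mult)
  define s where "s = (m - 1) * (5 * m - 1)"
  \<comment> \<open>The radicand is \<open>n\<^sup>2 s\<close>, and \<open>6 sqrt s \<le> s + 9\<close> is the arithmetic-geometric mean inequality for
    \<open>s\<close> and \<open>9\<close>, the value of \<open>s\<close> at \<open>m = 2\<close>.\<close>
  have "sqrt (((m - 1) * n)\<^sup>2 + 4 * m * ((m - 1) * n) * n) \<le> n * (s + 9) / 6"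
  proof (rule real_le_lsqrt)
    have s: "s \<ge> 0" using m by (simp add: s_def)
    then show "0 \<le> n * (s + 9) / 6" using n by simp
    have "36 * s \<le> (s + 9)\<^sup>2"
      using zero_le_power2[of "s - 9"] by (simp add: power2_eq_square algebra_simps)
    then have "n\<^sup>2 * s \<le> n\<^sup>2 * ((s + 9)\<^sup>2 / 36)"
      by (intro mult_left_mono) auto
    then show "((m - 1) * n)\<^sup>2 + 4 * m * ((m - 1) * n) * n \<le> (n * (s + 9) / 6)\<^sup>2"
      by (simp add: s_def power2_eq_square algebra_simps)
  qed
  moreover have "(m - 1) * n + n * (s + 9) / 6 \<le>
      e * (3 * m * (m - 1)) + m * (e * (m * (m - 1) + 1)) + (m - 2) * (e * (m * (m - 2)))"
  proof -
    have "0 \<le> e * ((m - 2)\<^sup>2 * (2 * m + 1))" using e(1) m by simp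
    also have "\<dots> =
      6 * (e * (3 * m * (m - 1)) + m * (e * (m * (m - 1) + 1)) + (m - 2) * (e * (m * (m - 2)))) -
      6 * ((m - 1) * n + n * (s + 9) / 6)"
      unfolding s_def e(2) by (simp add: power2_eq_square field_simps)
    finally show ?thesis by simp
  qed
  moreover have "(m - 2) * (e * (m * (m - 2))) \<le> ((m - 1) * n - 1) * (e * (m * (m - 2)))"
  proof (rule mult_right_mono)
    have "(m - 1) * 1 \<le> (m - 1) * n" using m n by (intro mult_left_mono) auto
    then show "m - 2 \<le> (m - 1) * n - 1" by simp
  qed (use e(1) m in simp)
  moreover have "0 \<le> m * ((n - 1) * (e * ((m - 1) * (m - 2))))" using e(1) m n by simp
  ultimately show ?thesis
    unfolding abs unfolding d by linarith
qed

context complete_multipartite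
begin

theorem energy_le_laplacian_energy:
  fixes m n :: nat
  assumes p0: "p0 \<in> parts"
    and sizes: "part_size p0 = (m - 1) * n" "\<And>p. p \<in> parts - {p0} \<Longrightarrow> part_size p = n"
    and parts: "card parts = Suc m" and m: "m \<ge> 2" and n: "n \<ge> 1"
  shows "energy \<Gamma> \<le> laplacian_energy \<Gamma>"
proof -
  define N where "N = (2 * real m - 1) * real n"
  define d where "d = 3 * real m * (real m - 1) * real n / (2 * real m - 1)"
  have fin: "finite (parts - {p0})" and rest: "card (parts - {p0}) = m"
    using finite_parts p0 parts by simp_all
  have split: "parts = insert p0 (parts - {p0})" using p0 by blast
  have m1: "real (m - 1) = real m - 1" using m by (simp add: of_nat_diff)
  have nonempty: "verts \<Gamma> \<noteq> {}" using p0 by (auto simp: parts_def)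
  have card: "card (verts \<Gamma>) = (m - 1) * n + m * n"
    unfolding card_verts_by_part by (subst split, subst sum.insert) (use fin sizes rest in auto)
  have N: "real (card (verts \<Gamma>)) = N"
    unfolding card of_nat_add of_nat_mult m1 N_def by (simp add: algebra_simps)
  have "2 * card (edges \<Gamma>) = (m - 1) * n * (m * n) + m * (n * ((m - 1) * n + m * n - n))"
    unfolding two_card_edges card by (subst split, subst sum.insert) (use fin sizes rest in auto)
  also have "(m - 1) * n + m * n - n = (m - 1) * n + (m - 1) * n"
    by (simp add: algebra_simps)
  finally have "2 * real (card (edges \<Gamma>)) =
      (real m - 1) * n * (m * n) + m * (n * ((real m - 1) * n + (real m - 1) * n))"
    unfolding m1[symmetric] of_nat_mult[symmetric] of_nat_add[symmetric] by linarith
  then have "2 * real (card (edges \<Gamma>)) = 3 * m * (real m - 1) * n * n"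
    by (simp add: algebra_simps)
  moreover have "N \<noteq> 0" "2 * real m - 1 \<noteq> 0" using m n by (auto simp: N_def)
  ultimately have d: "2 * real (card (edges \<Gamma>)) / real (card (verts \<Gamma>)) = d"
    unfolding N by (simp add: d_def N_def)
  have "energy \<Gamma> = real (m - 1) * n + sqrt ((real (m - 1) * n)\<^sup>2 + 4 * real m * real ((m - 1) * n) * n)"
    by (rule energy_two_sizes[OF p0 sizes parts]) (use m in auto)
  also have "\<dots> = (real m - 1) * n + sqrt (((real m - 1) * n)\<^sup>2 + 4 * real m * ((real m - 1) * n) * n)"
    by (simp only: m1 of_nat_mult)
  also have "\<dots> \<le> d + m * \<bar>N - d\<bar> + (((real m - 1) * n - 1) * \<bar>N - (real m - 1) * n - d\<bar> +
      m * ((real n - 1) * \<bar>N - n - d\<bar>))"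
    unfolding N_def d_def by (rule energy_inequality) (use m n in auto)
  also have "\<dots> = laplacian_energy \<Gamma>"
  proof -
    have "(\<Sum>p\<in>parts. real (part_size p - 1) * \<bar>N - real (part_size p) - d\<bar>) =
      real ((m - 1) * n - 1) * \<bar>N - real ((m - 1) * n) - d\<bar> + m * (real (n - 1) * \<bar>N - n - d\<bar>)"
      by (subst split, subst sum.insert) (use fin sizes rest in auto)
    moreover have "real ((m - 1) * n - 1) = real ((m - 1) * n) - 1"
      using part_size_pos[OF p0] unfolding sizes(1) by linarith
    moreover have "real ((m - 1) * n) = (real m - 1) * n"
      by (simp only: of_nat_mult m1)
    ultimately show ?thesis
      using laplacian_energy_eq[OF nonempty] n unfolding d unfolding N parts
      by (simp add: m1 of_nat_diff)
  qed
  finally show ?thesis .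
qed

end


section \<open>Groups with an abelian subgroup of index two\<close>

lemma (in group) center_subgroup: "subgroup (center G) G"
  using center_normal by (rule normal_imp_subgroup)

text \<open>The covering condition only says that \<open>A\<close> has index at most two; non-commutativity of \<open>G\<close> forces
\<open>b\<close> to lie outside \<open>A\<close>, and hence the index to be two.\<close>

locale abelian_index_two = group G for G (structure) +
  fixes A b
  assumes finite_carrier: "finite (carrier G)"
    and nonabelian: "center G \<noteq> carrier G"
    and subgroup_A: "subgroup A G"
    and abelian_A: "\<And>x y. x \<in> A \<Longrightarrow> y \<in> A \<Longrightarrow> x \<otimes> y = y \<otimes> x"
    and b_closed: "b \<in> carrier G"
    and cover: "carrier G \<subseteq> A \<union> (A #> b)"
begin

abbreviation Z where "Z \<equiv> center G"

lemma central_commutes: "z \<in> Z \<Longrightarrow> x \<in> carrier G \<Longrightarrow> z \<otimes> x = x \<otimes> z"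
  by (auto simp: center_def)

lemma A_subset: "A \<subseteq> carrier G" and Z_subset: "Z \<subseteq> carrier G"
  using subgroup_A center_subgroup by (simp_all add: subgroup.subset)

lemma outside_A: "y \<in> carrier G \<Longrightarrow> y \<notin> A \<Longrightarrow> \<exists>x\<in>A. y = x \<otimes> b"
  using cover by (auto simp: r_coset_def)

lemma b_notin_A: "b \<notin> A"
proof
  assume "b \<in> A"
  then have "A #> b = A" by (rule coset_join2[OF b_closed subgroup_A])
  then have "carrier G = A" using cover A_subset by auto
  then have "Z = carrier G" using abelian_A by (auto simp: center_def)
  with nonabelian show False by simp
qed

text \<open>An element of \<open>A\<close> that commutes with \<open>x' b\<close> also commutes with \<open>x'\<close>, hence with \<open>b\<close>, hence with \<open>A\<close> and \<open>A b\<close>.\<close>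

lemma central_if_commutes_outside:
  assumes w: "w \<in> A" and x: "x \<in> carrier G" "x \<notin> A" and wx: "w \<otimes> x = x \<otimes> w"
  shows "w \<in> Z"
proof -
  obtain x' where x': "x' \<in> A" "x = x' \<otimes> b" using outside_A x by blast
  have cl: "w \<in> carrier G" "x' \<in> carrier G" using w x' A_subset by auto
  have "x' \<otimes> (w \<otimes> b) = w \<otimes> (x' \<otimes> b)"
    using cl b_closed abelian_A[OF w x'(1)] by (simp flip: m_assoc)
  also have "\<dots> = x' \<otimes> (b \<otimes> w)"
    using wx cl b_closed unfolding x'(2) by (simp add: m_assoc)
  finally have wb: "w \<otimes> b = b \<otimes> w" using cl b_closed by simp
  have "w \<otimes> y = y \<otimes> w" if y: "y \<in> carrier G" for y
  proof (cases "y \<in> A")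
    case False
    then obtain y' where y': "y' \<in> A" "y = y' \<otimes> b" using outside_A y by blast
    have cl': "y' \<in> carrier G" using y' A_subset by auto
    have "w \<otimes> (y' \<otimes> b) = y' \<otimes> (w \<otimes> b)"
      using cl cl' b_closed abelian_A[OF w y'(1)] by (simp flip: m_assoc)
    then show ?thesis unfolding y'(2) wb using cl cl' b_closed by (simp add: m_assoc)
  qed (rule abelian_A[OF w])
  then show ?thesis using cl by (simp add: center_def)
qed

text \<open>A central element outside \<open>A\<close> would commute with all of \<open>A\<close> and so make \<open>A\<close> central, and then \<open>b\<close> too.\<close>

lemma Z_subset_A: "Z \<subseteq> A"
proof (rule ccontr)
  assume "\<not> Z \<subseteq> A"
  then obtain z where z: "z \<in> Z" "z \<notin> A" by blast
  have zG: "z \<in> carrier G" using z Z_subset by auto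
  have AZ: "A \<subseteq> Z"
    using central_if_commutes_outside[OF _ zG z(2)] central_commutes[OF z(1)] A_subset
    by (metis subset_iff)
  obtain x where x: "x \<in> A" "z = x \<otimes> b" using outside_A zG z by blast
  have "inv x \<otimes> z \<in> Z"
    using x z AZ center_subgroup by (simp add: subgroup.m_closed subgroup.m_inv_closed subset_iff)
  moreover have "inv x \<otimes> z = b"
    using x A_subset b_closed by (simp add: m_assoc[symmetric] subset_iff)
  ultimately have "A #> b \<subseteq> Z"
    using AZ center_subgroup by (auto simp: r_coset_def subgroup.m_closed)
  then show False using AZ cover Z_subset nonabelian by auto
qed

lemma Z_psubset_A: "Z \<subset> A"
proof -
  have False if AZ: "A = Z"
  proof -
    have "b \<otimes> y = y \<otimes> b" if y: "y \<in> carrier G" for y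
    proof (cases "y \<in> A")
      case True
      then show ?thesis using AZ central_commutes[of y b] b_closed by simp
    next
      case False
      then obtain z where z: "z \<in> A" "y = z \<otimes> b" using outside_A y by blast
      then have "z \<otimes> b = b \<otimes> z" "z \<in> carrier G"
        using AZ central_commutes[of z b] b_closed A_subset by auto
      then show ?thesis using m_assoc[of b z b] b_closed by (simp add: z(2))
    qed
    then have "b \<in> Z" using b_closed by (simp add: center_def)
    then show False using AZ b_notin_A by simp
  qed
  then show ?thesis using Z_subset_A by auto
qed

lemma coset_disjoint:
  assumes H: "H \<subseteq> A" "subgroup H G" and x: "x \<in> carrier G" "x \<notin> A"
  shows "(H #> x) \<inter> A = {}"
proof (rule ccontr)
  assume "(H #> x) \<inter> A \<noteq> {}"
  then obtain z where z: "z \<in> H" "z \<otimes> x \<in> A" by (auto simp: r_coset_def)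
  then have "inv z \<otimes> (z \<otimes> x) \<in> A"
    using subgroup_A H by (simp add: subgroup.m_closed subgroup.m_inv_closed subset_iff)
  moreover have "inv z \<otimes> (z \<otimes> x) = x"
    using x z H A_subset by (simp add: m_assoc[symmetric] subset_iff)
  ultimately show False using x by simp
qed

lemma card_carrier: "card (carrier G) = 2 * card A"
proof -
  have "carrier G = A \<union> (A #> b)"
    using cover A_subset r_coset_subset_G[OF A_subset b_closed] by blast
  moreover have "A \<inter> (A #> b) = {}"
    using coset_disjoint[OF subset_refl subgroup_A b_closed b_notin_A] by blast
  moreover have "card (A #> b) = card A"
    by (rule card_rcosets_equal[symmetric]) (use A_subset b_closed in \<open>auto intro: rcosetsI\<close>)
  ultimately show ?thesis
    using finite_carrier by (metis card_Un_disjoint finite_Un mult_2)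
qed

definition part :: "'a \<Rightarrow> 'a set" where
  "part x = (if x \<in> A then A else Z #> x)"

lemma Z_coset_eq_iff:
  assumes "x \<in> carrier G" "y \<in> carrier G"
  shows "Z #> x = Z #> y \<longleftrightarrow> y \<in> Z #> x"
  using repr_independence[OF _ assms(1) center_subgroup]
    repr_independenceD[OF center_subgroup assms(2)] by blast

lemma Z_coset_neq_A: "x \<in> carrier G \<Longrightarrow> x \<notin> A \<Longrightarrow> Z #> x \<noteq> A"
  using rcos_self[OF _ center_subgroup] by (metis (full_types))

text \<open>The case of two elements outside \<open>A\<close> carries the idea: \<open>w = y x\<inverse>\<close> lies in \<open>A\<close>, and \<open>x\<close> commutes with
\<open>y = w x\<close> if and only if it commutes with \<open>w\<close>, that is, if and only if \<open>w\<close> is central.\<close>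

lemma commute_iff_same_part:
  assumes x: "x \<in> carrier G" "x \<notin> Z" and y: "y \<in> carrier G" "y \<notin> Z"
  shows "x \<otimes> y = y \<otimes> x \<longleftrightarrow> part x = part y"
proof -
  consider "x \<in> A" "y \<in> A" | "x \<in> A" "y \<notin> A" | "x \<notin> A" "y \<in> A" | "x \<notin> A" "y \<notin> A" by blast
  then show ?thesis
  proof cases
    case 1
    then show ?thesis by (simp add: part_def abelian_A)
  next
    case 2
    then show ?thesis
      using central_if_commutes_outside[of x y] x y Z_coset_neq_A[of y] by (auto simp: part_def)
  next
    case 3
    then show ?thesis
      using central_if_commutes_outside[of y x] x y Z_coset_neq_A[of x] by (auto simp: part_def)
  next
    case 4
    obtain x' y' where xy': "x' \<in> A" "x = x' \<otimes> b" "y' \<in> A" "y = y' \<otimes> b"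
      using outside_A 4 x(1) y(1) by blast
    have cl: "x' \<in> carrier G" "y' \<in> carrier G" using xy' A_subset by auto
    define w where "w = y \<otimes> inv x"
    have "y = (y' \<otimes> inv x') \<otimes> x"
      using cl b_closed by (simp add: xy'(2,4) m_assoc) (simp add: m_assoc[symmetric])
    then have "w = y' \<otimes> inv x'"
      using cl x(1) unfolding w_def by (metis inv_closed inv_solve_right m_closed y(1))
    then have wA: "w \<in> A" using xy' subgroup_A by (simp add: subgroup.m_closed subgroup.m_inv_closed)
    then have wG: "w \<in> carrier G" using A_subset by auto
    have y_eq: "y = w \<otimes> x" using x y by (simp add: w_def m_assoc)
    have "x \<otimes> y = y \<otimes> x \<longleftrightarrow> (x \<otimes> w) \<otimes> x = (w \<otimes> x) \<otimes> x"
      using x wG by (simp add: y_eq m_assoc)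
    also have "\<dots> \<longleftrightarrow> w \<otimes> x = x \<otimes> w" using x wG by (metis m_closed right_cancel)
    also have "\<dots> \<longleftrightarrow> w \<in> Z"
      using central_if_commutes_outside[OF wA x(1) 4(1)] central_commutes[of w x] x by blast
    also have "\<dots> \<longleftrightarrow> y \<in> Z #> x"
      unfolding w_def by (rule subgroup.rcos_module[OF center_subgroup is_group x(1) y(1), symmetric])
    finally show ?thesis using 4 Z_coset_eq_iff x y by (simp add: part_def)
  qed
qed

lemma verts_eq: "verts (noncommuting_graph G) = carrier G - Z"
  by (simp add: noncommuting_graph_def)

sublocale complete_multipartite "noncommuting_graph G" part
proof
  show "finite (verts (noncommuting_graph G))" using finite_carrier by (simp add: verts_eq)
  have "edges (noncommuting_graph G) =
    {{x, y} |x y. x \<in> carrier G - Z \<and> y \<in> carrier G - Z \<and> x \<otimes> y \<noteq> y \<otimes> x}"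
    by (simp add: noncommuting_graph_def)
  also have "\<dots> = {{x, y} |x y. x \<in> carrier G - Z \<and> y \<in> carrier G - Z \<and> part x \<noteq> part y}"
    using commute_iff_same_part by (intro Collect_cong ex_cong1 conj_cong refl) auto
  finally show "edges (noncommuting_graph G) =
    {{x, y} |x y. x \<in> verts (noncommuting_graph G) \<and> y \<in> verts (noncommuting_graph G) \<and> part x \<noteq> part y}"
    unfolding verts_eq .
qed

lemma finite_A: "finite A" and finite_Z: "finite Z"
  using finite_carrier A_subset Z_subset by (auto intro: finite_subset)

lemma part_size_A: "part_size A = card A - card Z"
proof -
  have "{x \<in> verts (noncommuting_graph G). part x = A} = A - Z"
    using A_subset Z_coset_neq_A by (auto simp: verts_eq part_def)
  then show ?thesis using Z_subset_A finite_Z by (simp add: part_size_def card_Diff_subset)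
qed

lemma part_size_coset:
  assumes "p \<in> parts - {A}"
  shows "part_size p = card Z"
proof -
  obtain x where x: "x \<in> carrier G" "x \<notin> A" "p = Z #> x"
    using assms by (auto simp: parts_def verts_eq part_def split: if_splits)
  have eq_iff: "Z #> y = Z #> x \<longleftrightarrow> y \<in> Z #> x" if "y \<in> carrier G" for y
    using Z_coset_eq_iff[OF x(1) that] by blast
  have "{y \<in> verts (noncommuting_graph G). part y = p} = Z #> x"
    using Z_coset_neq_A[OF x(1,2)] coset_disjoint[OF Z_subset_A center_subgroup x(1,2)]
      eq_iff Z_subset_A r_coset_subset_G[OF Z_subset x(1)]
    by (auto simp: verts_eq part_def x(3))
  then show ?thesis
    using card_rcosets_equal[OF rcosetsI[OF Z_subset x(1)] Z_subset] by (simp add: part_size_def)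
qed

lemma A_in_parts: "A \<in> parts"
proof -
  obtain x where "x \<in> A" "x \<notin> Z" using Z_psubset_A by blast
  then have "x \<in> verts (noncommuting_graph G)" "part x = A"
    using A_subset by (auto simp: verts_eq part_def)
  then show ?thesis unfolding parts_def by (metis imageI)
qed

theorem noncommuting_energy_le_laplacian_energy:
  "energy (noncommuting_graph G) \<le> laplacian_energy (noncommuting_graph G)"
proof -
  \<comment> \<open>Counting the vertices part by part shows that the number of cosets outside \<open>A\<close> is the index of \<open>Z\<close>
    in \<open>A\<close>.\<close>
  define m where "m = card (parts - {A})"
  have le: "card Z \<le> card A" "card Z < card A"
    using Z_psubset_A finite_A by (simp_all add: psubset_card_mono less_imp_le)
  have "2 * card A - card Z = card (verts (noncommuting_graph G))"
    using card_carrier Z_subset finite_Z by (simp add: verts_eq card_Diff_subset)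
  also have "\<dots> = part_size A + (\<Sum>p\<in>parts - {A}. part_size p)"
    unfolding card_verts_by_part using A_in_parts finite_parts by (simp add: sum.remove)
  also have "\<dots> = card A - card Z + m * card Z"
    using part_size_coset by (simp add: part_size_A m_def)
  finally have card_A: "card A = m * card Z" using le by simp
  have Z_pos: "card Z \<ge> 1"
    using finite_Z subgroup.one_closed[OF center_subgroup] by (auto simp: Suc_le_eq card_gt_0_iff)
  have "m \<ge> 2"
  proof (rule ccontr)
    assume "\<not> m \<ge> 2"
    then have "m * card Z \<le> 1 * card Z" by (intro mult_right_mono) auto
    then show False using le card_A by simp
  qed
  show ?thesis
  proof (rule energy_le_laplacian_energy[OF A_in_parts _ part_size_coset _ \<open>m \<ge> 2\<close> Z_pos])
    show "part_size A = (m - 1) * card Z"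
      by (simp add: part_size_A card_A diff_mult_distrib)
    show "card parts = Suc m"
      unfolding m_def by (rule card_Suc_Diff1[OF finite_parts A_in_parts, symmetric])
  qed
qed

end


section \<open>Groups with dihedral central quotient\<close>

text \<open>Let \<open>a\<close> and \<open>b\<close> map to the two generators under the projection \<open>\<pi>\<close> of \<open>G\<close> to the dihedral group, whose
kernel is the centre. The normal form \<open>a\<^sup>k b\<^sup>s\<close> in the dihedral group says that every element of \<open>G\<close> is a central
element times \<open>a\<^sup>k\<close> or \<open>a\<^sup>k b\<close>, so the abelian subgroup generated by the centre and \<open>a\<close> has at most
the two cosets required. The group is not abelian because its central quotient is not trivial.\<close>

lemma dihedral_quotient_abelian_index_two:
  fixes G (structure)
  assumes "group G" and fin: "finite (carrier G)" and m: "m > 0"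
    and iso: "(G Mod center G) \<cong> dihedral_group m"
  shows "\<exists>A b. abelian_index_two G A b"
proof -
  interpret group G by fact
  let ?Z = "center G" and ?R = "dihedral_relations m" and ?D = "dihedral_group m"
  have Z: "subgroup ?Z G" by (rule center_subgroup)
  have Zc: "z \<otimes> x = x \<otimes> z" if "z \<in> ?Z" "x \<in> carrier G" for z x
    using that by (auto simp: center_def)
  have ZG: "z \<in> carrier G" if "z \<in> ?Z" for z using that by (auto simp: center_def)
  interpret D: group ?D unfolding dihedral_group_def by (rule group_presented_group)
  obtain h where h: "h \<in> iso (G Mod ?Z) ?D" using iso by (auto simp: is_iso_def)
  define \<pi> where "\<pi> x = h (?Z #> x)" for x
  have "\<pi> \<in> hom G ?D"
    using hom_compose[OF normal.r_coset_hom_Mod[OF center_normal] iso_imp_homomorphism[OF h]]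
    by (auto simp: hom_def compose_def \<pi>_def Pi_def)
  then interpret \<pi>: group_hom G ?D \<pi> by unfold_locales
  have bij: "bij_betw h (rcosets ?Z) (carrier ?D)"
    using h by (auto simp: iso_def FactGroup_def)
  have fibre: "\<exists>z\<in>?Z. x = z \<otimes> y" if "\<pi> x = \<pi> y" and x: "x \<in> carrier G" and y: "y \<in> carrier G" for x y
  proof -
    have "?Z #> x = ?Z #> y"
      using bij that rcosetsI[OF subgroup.subset[OF Z]] unfolding \<pi>_def bij_betw_def
      by (metis inj_onD)
    then have "x \<in> ?Z #> y" using rcos_self[OF x Z] by simp
    then show ?thesis by (auto simp: r_coset_def)
  qed
  have surj: "\<exists>x\<in>carrier G. \<pi> x = word_class ?R u" for u
  proof -
    have "word_class ?R u \<in> carrier ?D" by (simp add: dihedral_group_def carrier_presented_group)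
    then obtain X where "X \<in> rcosets ?Z" "h X = word_class ?R u"
      using bij by (metis bij_betw_imp_surj_on imageE)
    then show ?thesis by (auto simp: RCOSETS_def \<pi>_def)
  qed
  obtain a where a: "a \<in> carrier G" "\<pi> a = word_class ?R [(GenA, True)]" using surj by blast
  obtain b where b: "b \<in> carrier G" "\<pi> b = word_class ?R [(GenB, True)]" using surj by blast
  have pow: "\<pi> (a [^] k) = word_class ?R (replicate k (GenA, True))" for k :: nat
  proof (induction k)
    case 0
    then show ?case by (simp add: dihedral_group_def one_presented_group)
  next
    case (Suc k)
    then show ?case
      using a by (simp add: dihedral_group_def mult_presented_group replicate_append_same)
  qed
  define A where "A = {z \<otimes> a [^] k | z k. z \<in> ?Z \<and> k \<in> (UNIV :: int set)}"
  have prod: "(z \<otimes> a [^] k) \<otimes> (z' \<otimes> a [^] l) = (z \<otimes> z') \<otimes> a [^] (k + l)"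
    if "z \<in> ?Z" "z' \<in> ?Z" for z z' and k l :: int
  proof -
    have "(z \<otimes> a [^] k) \<otimes> (z' \<otimes> a [^] l) = z \<otimes> (a [^] k \<otimes> z') \<otimes> a [^] l"
      using that ZG a by (simp add: m_assoc)
    also have "a [^] k \<otimes> z' = z' \<otimes> a [^] k" using Zc[OF that(2)] a by simp
    finally show ?thesis using that ZG a by (simp add: m_assoc int_pow_mult)
  qed
  have comm: "x \<otimes> y = y \<otimes> x" if "x \<in> A" "y \<in> A" for x y
  proof -
    obtain z k z' l where "x = z \<otimes> a [^] (k :: int)" "y = z' \<otimes> a [^] (l :: int)" "z \<in> ?Z" "z' \<in> ?Z"
      using \<open>x \<in> A\<close> \<open>y \<in> A\<close> unfolding A_def by blast
    then show ?thesis using Zc[of z z'] ZG by (simp add: prod add.commute)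
  qed
  have subgroup_A: "subgroup A G"
  proof (rule subgroupI)
    show "A \<subseteq> carrier G" using ZG a by (auto simp: A_def)
    show "A \<noteq> {}" using subgroup.one_closed[OF Z] by (auto simp: A_def)
  next
    fix x assume "x \<in> A"
    then obtain z and k :: int where x: "x = z \<otimes> a [^] k" "z \<in> ?Z" by (auto simp: A_def)
    have "inv x = inv (a [^] k) \<otimes> inv z" using x ZG a by (simp add: inv_mult_group)
    also have "\<dots> = inv z \<otimes> a [^] (- k)"
      using Zc[of "inv z" "inv (a [^] k)"] subgroup.m_inv_closed[OF Z x(2)] a by (simp add: int_pow_neg)
    finally show "inv x \<in> A" using subgroup.m_inv_closed[OF Z x(2)] by (auto simp: A_def)
  next
    fix x y assume "x \<in> A" "y \<in> A"
    then obtain z k z' l where xy: "x = z \<otimes> a [^] (k :: int)" "y = z' \<otimes> a [^] (l :: int)" "z \<in> ?Z" "z' \<in> ?Z"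
      unfolding A_def by blast
    then show "x \<otimes> y \<in> A" using subgroup.m_closed[OF Z] by (auto simp: A_def prod)
  qed
  have cover: "carrier G \<subseteq> A \<union> (A #> b)"
  proof
    fix x assume x: "x \<in> carrier G"
    then have "\<pi> x \<in> carrier ?D" by simp
    then obtain u where u: "\<pi> x = word_class ?R u"
      by (auto simp: dihedral_group_def carrier_presented_group)
    obtain k s where ks: "word_eq ?R u (replicate k (GenA, True) @ (if s then [(GenB, True)] else []))"
      using dihedral_normal_form[OF m] by blast
    have powA: "z \<otimes> a [^] k \<in> A" if "z \<in> ?Z" for z
      using that int_pow_int[of G a k] unfolding A_def by (metis (mono_tags, lifting) CollectI UNIV_I)
    show "x \<in> A \<union> (A #> b)"
    proof (cases s)
      case True
      have "\<pi> x = word_class ?R (replicate k (GenA, True) @ [(GenB, True)])"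
        using ks True u word_class_eq_iff by (metis (full_types))
      also have "\<dots> = \<pi> (a [^] k \<otimes> b)"
        using a b pow by (simp add: dihedral_group_def mult_presented_group)
      finally obtain z where z: "z \<in> ?Z" "x = z \<otimes> (a [^] k \<otimes> b)" using fibre x a b by (metis m_closed nat_pow_closed)
      then have "x = (z \<otimes> a [^] k) \<otimes> b" using ZG a b by (simp add: m_assoc)
      then show ?thesis using powA[OF z(1)] by (auto simp: r_coset_def)
    next
      case False
      have "\<pi> x = \<pi> (a [^] k)"
        unfolding u pow word_class_eq_iff using ks False by simp
      then obtain z where "z \<in> ?Z" "x = z \<otimes> a [^] k" using fibre x a by (metis nat_pow_closed)
      then show ?thesis using powA by simp
    qed
  qed
  have "?Z \<noteq> carrier G"
  proof
    assume eq: "?Z = carrier G"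
    have "rcosets ?Z = {carrier G}"
      using coset_join2[OF _ subgroup_self] one_closed by (auto simp: RCOSETS_def eq)
    then have "card (carrier ?D) = 1" using bij_betw_same_card[OF bij] by simp
    then show False using card_dihedral_group[OF m] by simp
  qed
  then have "abelian_index_two G A b"
    using fin subgroup_A comm b(1) cover is_group
    by (intro abelian_index_two.intro abelian_index_two_axioms.intro)
  then show ?thesis by blast
qed

theorem theorem4p8:
  fixes G :: "('a, 'c) monoid_scheme" and m :: nat
  assumes "group G"
    and "finite (carrier G)"
    and "m > 0"
    and "(G Mod center G) \<cong> dihedral_group m"
  shows "energy (noncommuting_graph G) \<le> laplacian_energy (noncommuting_graph G)"
proof -
  obtain A b where "abelian_index_two G A b"
    using dihedral_quotient_abelian_index_two[OF assms] by blast
  then show ?thesis by (rule abelian_index_two.noncommuting_energy_le_laplacian_energy)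
qed

end
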